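(* Let $Q$ be an $n\times n$ Laplacian matrix with rows and columns indexed by a finite set $\mathcal{N}$, $|\mathcal{N}|=n$, let $\mathcal{V}\subset\mathcal{N}$ be a proper subset with $|\mathcal{V}|\geq 2$, and write $\mathcal{V}^c=\mathcal{N}\setminus\mathcal{V}$. Then the Schur complement $$Q/\mathcal{V}^c = Q_{\mathcal{V}\mathcal{V}} - Q_{\mathcal{V}\mathcal{V}^c}(Q_{\mathcal{V}^c\mathcal{V}^c})^{-1}Q_{\mathcal{V}^c\mathcal{V}}$$ is again a Laplacian matrix (with rows and columns indexed by $\mathcal{V}$).
   Context: A weighted graph $G=(\mathcal{N},\mathcal{L},w)$ consists of a finite set $\mathcal{N}$ of $n\geq 2$ nodes, a set $\mathcal{L}$ of links, which are unordered pairs of distinct nodes, and positive real weights $w_{ij}=w_{ji}$ on the links $(i,j)\in\mathcal{L}$; all graphs are assumed connected. The Laplacian matrix of $G$ is the $n\times n$ matrix $Q$ with $(Q)_{ii}=d_i=\sum_{(i,j)\in\mathcal{L}}w_{ij}$, $(Q)_{ij}=-w_{ij}$ if $(i,j)\in\mathcal{L}$, and $(Q)_{ij}=0$ otherwise. A matrix is called a Laplacian matrix if it is the Laplacian matrix of some such weighted graph. For a Laplacian matrix $Q$ and a nonempty proper subset $\mathcal{V}\subset\mathcal{N}$, the principal submatrix $Q_{\mathcal{V}^c\mathcal{V}^c}$ is invertible, so the Schur complement is well defined. *)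

theory Defs
  imports Complex_Main
begin

text \<open>
  A real matrix with rows and columns indexed by a finite set \<open>N\<close> is a function
  \<open>'a \<Rightarrow> 'a \<Rightarrow> real\<close> of which only the entries with both indices in \<open>N\<close> matter.
  The block with rows in \<open>R\<close> and columns in \<open>C\<close> is thus the same function, read on
  \<open>R \<times> C\<close>; index sets appear explicitly in products and inverses.
\<close>

type_synonym 'a matr = "'a \<Rightarrow> 'a \<Rightarrow> real"

text \<open>Links are two-element sets of nodes; values of \<open>w\<close> off the links are irrelevant.\<close>

definition weighted_graph :: "'a set \<Rightarrow> 'a set set \<Rightarrow> 'a matr \<Rightarrow> bool" where
  "weighted_graph N L w \<longleftrightarrow>
     finite N \<and> card N \<ge> 2 \<and>
     L \<subseteq> {{i, j} | i j. i \<in> N \<and> j \<in> N \<and> i \<noteq> j} \<and>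
     (\<forall>i j. {i, j} \<in> L \<longrightarrow> w i j > 0 \<and> w i j = w j i) \<and>
     (\<forall>i\<in>N. \<forall>j\<in>N. (i, j) \<in> {(u, v). {u, v} \<in> L}\<^sup>*)"

definition laplacian :: "'a set \<Rightarrow> 'a set set \<Rightarrow> 'a matr \<Rightarrow> 'a matr" where
  "laplacian N L w i j =
     (if i = j then (\<Sum>k | k \<in> N \<and> {i, k} \<in> L. w i k)
      else if {i, j} \<in> L then - w i j
      else 0)"

definition is_laplacian :: "'a set \<Rightarrow> 'a matr \<Rightarrow> bool" where
  "is_laplacian N Q \<longleftrightarrow>
     (\<exists>L w. weighted_graph N L w \<and> (\<forall>i\<in>N. \<forall>j\<in>N. Q i j = laplacian N L w i j))"

definition mult_on :: "'a set \<Rightarrow> 'a matr \<Rightarrow> 'a matr \<Rightarrow> 'a matr" where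
  "mult_on K A B = (\<lambda>i j. \<Sum>k\<in>K. A i k * B k j)"

definition is_inverse_on :: "'a set \<Rightarrow> 'a matr \<Rightarrow> 'a matr \<Rightarrow> bool" where
  "is_inverse_on W A B \<longleftrightarrow>
     (\<forall>i\<in>W. \<forall>j\<in>W. mult_on W A B i j = (if i = j then 1 else 0) \<and>
                    mult_on W B A i j = (if i = j then 1 else 0))"

text \<open>
  The inverse of the block of \<open>A\<close> on \<open>W \<times> W\<close>. As with \<open>matrix_inv\<close> in HOL-Analysis,
  it is meaningful only if an inverse exists; its entries on \<open>W \<times> W\<close> are then unique,
  and the others are arbitrary.
\<close>

definition inverse_on :: "'a set \<Rightarrow> 'a matr \<Rightarrow> 'a matr" where
  "inverse_on W A = (SOME B. is_inverse_on W A B)"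

text \<open>
  The Schur complement \<open>Q/W\<close>, to be read on the indices outside \<open>W\<close>.
\<close>

definition schur_complement :: "'a matr \<Rightarrow> 'a set \<Rightarrow> 'a matr" where
  "schur_complement Q W =
     (\<lambda>i j. Q i j - mult_on W (mult_on W Q (inverse_on W Q)) Q i j)"

end

theory Submission
  imports Defs
begin

text \<open>
  A Laplacian matrix is a symmetric matrix with nonpositive off-diagonal entries and zero row sums
  that is irreducible. Such matrices satisfy a minimum principle: a vector \<open>x\<close> with
  \<open>(Q x)\<^sub>i \<ge> 0\<close> at all its minimisers is constant. Hence the block of \<open>Q\<close> on \<open>W \<noteq> N\<close> is
  inverse-positive, and the solution \<open>H\<close> of \<open>Q\<^sub>W\<^sub>W H = Q\<^sub>W\<^sub>V\<close> is nonpositive with row sums \<open>-1\<close>; this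
  gives the signs and the row sums of \<open>Q\<^sub>V\<^sub>V - Q\<^sub>V\<^sub>W H\<close>. If that matrix decoupled a set \<open>T\<close> from the
  rest of \<open>V\<close>, then the extension of the indicator of \<open>T\<close> by the harmonic values
  \<open>- (\<Sum>j\<in>T. H k j)\<close> on \<open>W\<close> would be a non-constant element of the kernel of \<open>Q\<close>.
\<close>

section \<open>Laplacian matrices characterised without a graph\<close>

definition irreducible_laplacian :: "'a set \<Rightarrow> 'a matr \<Rightarrow> bool" where
  "irreducible_laplacian N Q \<longleftrightarrow>
     finite N \<and> card N \<ge> 2 \<and>
     (\<forall>i\<in>N. \<forall>j\<in>N. Q i j = Q j i) \<and>
     (\<forall>i\<in>N. \<forall>j\<in>N. i \<noteq> j \<longrightarrow> Q i j \<le> 0) \<and>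
     (\<forall>i\<in>N. (\<Sum>j\<in>N. Q i j) = 0) \<and>
     (\<forall>T. T \<noteq> {} \<longrightarrow> T \<subset> N \<longrightarrow> (\<exists>i\<in>T. \<exists>j\<in>N-T. Q i j \<noteq> 0))"

lemma rtrancl_leaves_set:
  assumes "(i, j) \<in> R\<^sup>*" "i \<in> T" "j \<notin> T"
  shows "\<exists>a b. (a, b) \<in> R \<and> a \<in> T \<and> b \<notin> T"
  using assms by (induction rule: rtrancl_induct) auto

text \<open>A path from a node of \<open>T\<close> to a node outside it must use a link crossing the
  boundary of \<open>T\<close>; this turns connectedness by paths into a condition on cuts.\<close>

lemma is_laplacian_imp_irreducible:
  assumes "is_laplacian N Q"
  shows "irreducible_laplacian N Q"
proof -
  obtain L w where g: "weighted_graph N L w"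
    and Q: "\<And>i j. i \<in> N \<Longrightarrow> j \<in> N \<Longrightarrow> Q i j = laplacian N L w i j"
    using assms unfolding is_laplacian_def by blast
  have fin: "finite N" and c2: "card N \<ge> 2"
    and LN: "L \<subseteq> {{i, j} | i j. i \<in> N \<and> j \<in> N \<and> i \<noteq> j}"
    and w: "\<And>i j. {i, j} \<in> L \<Longrightarrow> w i j > 0 \<and> w i j = w j i"
    and conn: "\<And>i j. i \<in> N \<Longrightarrow> j \<in> N \<Longrightarrow> (i, j) \<in> {(u, v). {u, v} \<in> L}\<^sup>*"
    using g unfolding weighted_graph_def by auto
  have L: "i \<in> N \<and> j \<in> N \<and> i \<noteq> j" if "{i, j} \<in> L" for i j
    using that LN by (auto simp: doubleton_eq_iff subset_iff)
  have "Q i j = Q j i" if "i \<in> N" "j \<in> N" for i j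
    using that w[of i j] by (auto simp: Q laplacian_def insert_commute)
  moreover have "Q i j \<le> 0" if "i \<in> N" "j \<in> N" "i \<noteq> j" for i j
    using that w[of i j] by (auto simp: Q laplacian_def)
  moreover have "(\<Sum>j\<in>N. Q i j) = 0" if i: "i \<in> N" for i
  proof -
    have "(\<Sum>j\<in>N-{i}. Q i j) = (\<Sum>j\<in>N-{i}. if {i, j} \<in> L then - w i j else 0)"
      using i by (intro sum.cong) (auto simp: Q laplacian_def)
    also have "\<dots> = (\<Sum>j\<in>{k \<in> N. {i, k} \<in> L}. - w i j)"
      using fin L by (intro sum.mono_neutral_cong_right) auto
    also have "\<dots> = - Q i i"
      using i by (simp add: Q laplacian_def sum_negf)
    finally show ?thesis
      using fin i by (simp add: sum.remove)
  qed
  moreover have "\<exists>i\<in>T. \<exists>j\<in>N-T. Q i j \<noteq> 0" if T: "T \<noteq> {}" "T \<subset> N" for T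
  proof -
    obtain i j where ij: "i \<in> T" "j \<in> N" "j \<notin> T" "i \<in> N" using T by blast
    then obtain a b where ab: "{a, b} \<in> L" "a \<in> T" "b \<notin> T"
      using rtrancl_leaves_set[OF conn[of i j]] by blast
    with L[of a b] w[of a b] have "b \<in> N - T" "Q a b \<noteq> 0"
      by (auto simp: Q laplacian_def)
    with ab show ?thesis by blast
  qed
  ultimately show ?thesis
    using fin c2 unfolding irreducible_laplacian_def by blast
qed

text \<open>The graph is read off the matrix: nonzero off-diagonal entries become links, weighted by
  their negatives, and zero row sums make the diagonal the weighted degrees.\<close>

lemma irreducible_imp_is_laplacian:
  assumes "irreducible_laplacian N Q"
  shows "is_laplacian N Q"
proof -
  have fin: "finite N" and c2: "card N \<ge> 2"
    and sym: "\<And>i j. i \<in> N \<Longrightarrow> j \<in> N \<Longrightarrow> Q i j = Q j i"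
    and neg: "\<And>i j. i \<in> N \<Longrightarrow> j \<in> N \<Longrightarrow> i \<noteq> j \<Longrightarrow> Q i j \<le> 0"
    and row: "\<And>i. i \<in> N \<Longrightarrow> (\<Sum>j\<in>N. Q i j) = 0"
    and cut: "\<And>T. T \<noteq> {} \<Longrightarrow> T \<subset> N \<Longrightarrow> \<exists>i\<in>T. \<exists>j\<in>N-T. Q i j \<noteq> 0"
    using assms unfolding irreducible_laplacian_def by blast+
  define L where "L = {{i, j} | i j. i \<in> N \<and> j \<in> N \<and> i \<noteq> j \<and> Q i j \<noteq> 0}"
  define w where "w = (\<lambda>i j. - Q i j)"
  have L: "{i, j} \<in> L \<longleftrightarrow> i \<in> N \<and> j \<in> N \<and> i \<noteq> j \<and> Q i j \<noteq> 0" for i j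
    unfolding L_def using sym by (auto simp: doubleton_eq_iff)
  have conn: "(i, j) \<in> {(u, v). {u, v} \<in> L}\<^sup>*" if ij: "i \<in> N" "j \<in> N" for i j
  proof (rule ccontr)
    let ?R = "{(u, v). {u, v} \<in> L}"
    \<comment> \<open>No nonzero entry of \<open>Q\<close> leads out of the set of nodes reachable
      from \<open>i\<close>, which contradicts irreducibility if that set misses
      \<open>j\<close>.\<close>
    let ?T = "{k \<in> N. (i, k) \<in> ?R\<^sup>*}"
    assume "(i, j) \<notin> ?R\<^sup>*"
    with ij have "?T \<noteq> {}" "?T \<subset> N" by auto
    from cut[OF this] obtain a b where ab: "a \<in> ?T" "b \<in> N - ?T" "Q a b \<noteq> 0" by blast
    then have "(a, b) \<in> ?R" using L by auto
    with ab show False by (auto dest: rtrancl_into_rtrancl)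
  qed
  have "weighted_graph N L w"
    unfolding weighted_graph_def
  proof (intro conjI allI impI ballI)
    show "L \<subseteq> {{i, j} |i j. i \<in> N \<and> j \<in> N \<and> i \<noteq> j}" unfolding L_def by blast
  next
    fix i j assume "{i, j} \<in> L"
    then show "w i j > 0" "w i j = w j i"
      using neg[of i j] sym[of i j] by (auto simp: L w_def)
  qed (use fin c2 conn in auto)
  moreover have "Q i j = laplacian N L w i j" if ij: "i \<in> N" "j \<in> N" for i j
  proof (cases "i = j")
    case True
    have "(\<Sum>k | k \<in> N \<and> {i, k} \<in> L. w i k) = (\<Sum>k\<in>N-{i}. - Q i k)"
      using fin ij by (intro sum.mono_neutral_cong_left) (auto simp: L w_def)
    also have "\<dots> = Q i i"
      using row[OF ij(1)] fin ij by (simp add: sum_negf sum.remove[of N i])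
    finally show ?thesis using True by (simp add: laplacian_def)
  next
    case False
    with ij show ?thesis by (auto simp: laplacian_def L w_def)
  qed
  ultimately show ?thesis unfolding is_laplacian_def by blast
qed

section \<open>Linear systems and inverses from trivial kernels\<close>

text \<open>Elimination by bordering: one index \<open>p\<close> is added at a time. Trivial kernels
  are demanded of every sub-block because invertibility of a full block is not inherited by smaller
  ones.\<close>

lemma linear_system_solvable:
  fixes A :: "'a matr"
  assumes "finite W"
    and "\<And>U x. U \<subseteq> W \<Longrightarrow> \<forall>i\<in>U. (\<Sum>j\<in>U. A i j * x j) = 0 \<Longrightarrow> \<forall>i\<in>U. x i = 0"
  shows "\<exists>x. \<forall>i\<in>W. (\<Sum>j\<in>W. A i j * x j) = b i"
  using assms
proof (induction W arbitrary: b rule: finite_induct)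
  case empty
  then show ?case by simp
next
  case (insert p W)
  note ker = insert.prems
  have solve: "\<exists>x. \<forall>i\<in>W. (\<Sum>j\<in>W. A i j * x j) = b i" for b
    by (rule insert.IH, rule ker) auto
  obtain y where y: "\<forall>i\<in>W. (\<Sum>j\<in>W. A i j * y j) = b i"
    using solve by blast
  obtain z where z: "\<forall>i\<in>W. (\<Sum>j\<in>W. A i j * z j) = A i p"
    using solve[of "\<lambda>i. A i p"] by blast
  \<comment> \<open>The pivot: the Schur complement of the \<open>W\<close> block in the bordered
    block.\<close>
  define s where "s = A p p - (\<Sum>j\<in>W. A p j * z j)"
  \<comment> \<open>On a row \<open>i\<close> of \<open>W\<close> the image of \<open>v a t\<close>
    is \<open>a * b i\<close>, since the terms in \<open>t\<close> cancel by the choice of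
    \<open>z\<close>. So \<open>v 0 1\<close> would be a kernel vector if the pivot vanished, and
    \<open>v 1 t\<close> solves the system once \<open>t\<close> fits row \<open>p\<close>.\<close>
  define v where "v = (\<lambda>a t j. if j = p then t else a * y j - t * z j)"
  have v: "(\<Sum>j\<in>insert p W. A i j * v a t j)
      = A i p * t + a * (\<Sum>j\<in>W. A i j * y j) - t * (\<Sum>j\<in>W. A i j * z j)" for i a t
  proof -
    have "(\<Sum>j\<in>W. A i j * v a t j) = (\<Sum>j\<in>W. a * (A i j * y j) - t * (A i j * z j))"
      using insert.hyps by (intro sum.cong) (auto simp: v_def algebra_simps)
    then show ?thesis
      using insert.hyps by (simp add: v_def sum_subtractf sum_distrib_left)
  qed
  have "s \<noteq> 0"
  proof
    assume "s = 0"
    then have "\<forall>i\<in>insert p W. (\<Sum>j\<in>insert p W. A i j * v 0 1 j) = 0"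
      unfolding v using z by (auto simp: s_def)
    from ker[OF subset_refl this] show False by (simp add: v_def)
  qed
  define t where "t = (b p - (\<Sum>j\<in>W. A p j * y j)) / s"
  have "t * s = b p - (\<Sum>j\<in>W. A p j * y j)"
    using \<open>s \<noteq> 0\<close> by (simp add: t_def)
  then have "\<forall>i\<in>insert p W. (\<Sum>j\<in>insert p W. A i j * v 1 t j) = b i"
    unfolding v using y z by (auto simp: s_def algebra_simps)
  then show ?case by blast
qed

text \<open>Solving for the unit vectors gives a right inverse \<open>B\<close>. It is also a left
  inverse, because \<open>A (B A - I) = 0\<close> and the block of \<open>A\<close> has trivial
  kernel.\<close>

lemma is_inverse_on_exists:
  fixes A :: "'a matr"
  assumes fin: "finite W"
    and ker: "\<And>U x. U \<subseteq> W \<Longrightarrow> \<forall>i\<in>U. (\<Sum>j\<in>U. A i j * x j) = 0 \<Longrightarrow> \<forall>i\<in>U. x i = 0"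
  shows "\<exists>B. is_inverse_on W A B"
proof -
  have "\<forall>j. \<exists>x. \<forall>i\<in>W. (\<Sum>k\<in>W. A i k * x k) = (if i = j then 1 else 0)"
  proof
    show "\<exists>x. \<forall>i\<in>W. (\<Sum>k\<in>W. A i k * x k) = (if i = j then 1 else 0)" for j
      by (rule linear_system_solvable[OF fin], rule ker)
  qed
  then obtain C where C: "\<And>j i. i \<in> W \<Longrightarrow> (\<Sum>k\<in>W. A i k * C j k) = (if i = j then 1 else 0)"
    by metis
  define B where "B = (\<lambda>i j. C j i)"
  have AB: "(\<Sum>k\<in>W. A i k * B k j) = (if i = j then 1 else 0)" if "i \<in> W" for i j
    using C[OF that] by (simp add: B_def)
  have BA: "(\<Sum>k\<in>W. B i k * A k j) = (if i = j then 1 else 0)"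
    if i: "i \<in> W" and j: "j \<in> W" for i j
  proof -
    \<comment> \<open>Column \<open>j\<close> of \<open>B A - I\<close>.\<close>
    define x where "x = (\<lambda>i. (\<Sum>k\<in>W. B i k * A k j) - (if i = j then 1 else 0))"
    have "(\<Sum>l\<in>W. A h l * x l) = 0" if h: "h \<in> W" for h
    proof -
      have "(\<Sum>l\<in>W. A h l * (\<Sum>k\<in>W. B l k * A k j)) = (\<Sum>k\<in>W. (\<Sum>l\<in>W. A h l * B l k) * A k j)"
        unfolding sum_distrib_left sum_distrib_right
        by (subst sum.swap) (simp add: mult.assoc)
      also have "\<dots> = (\<Sum>k\<in>W. if k = h then A k j else 0)"
        by (intro sum.cong) (auto simp: AB h)
      also have "\<dots> = A h j" using h fin by simp
      finally have "(\<Sum>l\<in>W. A h l * (\<Sum>k\<in>W. B l k * A k j)) = A h j" .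
      moreover have "(\<Sum>l\<in>W. A h l * (if l = j then 1 else 0)) = A h j"
        using j fin by (simp add: if_distrib cong: if_cong)
      ultimately show ?thesis
        unfolding x_def right_diff_distrib sum_subtractf by simp
    qed
    with ker[of W x] i show ?thesis by (auto simp: x_def)
  qed
  have "is_inverse_on W A B"
    unfolding is_inverse_on_def mult_on_def using AB BA by auto
  then show ?thesis by blast
qed

section \<open>The minimum principle and proper principal blocks\<close>

context
  fixes N :: "'a set" and Q :: "'a matr"
  assumes lap: "irreducible_laplacian N Q"
begin

lemma laplacian_finite: "finite N"
  and laplacian_sym: "\<And>i j. i \<in> N \<Longrightarrow> j \<in> N \<Longrightarrow> Q i j = Q j i"
  and laplacian_nonpos: "\<And>i j. i \<in> N \<Longrightarrow> j \<in> N \<Longrightarrow> i \<noteq> j \<Longrightarrow> Q i j \<le> 0"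
  and laplacian_row_sum: "\<And>i. i \<in> N \<Longrightarrow> (\<Sum>j\<in>N. Q i j) = 0"
  and laplacian_cut: "\<And>T. T \<noteq> {} \<Longrightarrow> T \<subset> N \<Longrightarrow> \<exists>i\<in>T. \<exists>j\<in>N-T. Q i j \<noteq> 0"
  using lap unfolding irreducible_laplacian_def by blast+

text \<open>Zero row sums allow \<open>x p\<close> to be subtracted from every \<open>x j\<close> in
  row \<open>p\<close>. At a minimiser \<open>p\<close> joined to a non-minimiser \<open>q\<close>
  all terms are then nonpositive and the one at \<open>q\<close> is negative. Asking for the sign at
  minimisers only permits vectors whose image is known just on part of \<open>N\<close>.\<close>

lemma minimum_principle:
  assumes min: "\<And>i. i \<in> N \<Longrightarrow> \<forall>j\<in>N. x i \<le> x j \<Longrightarrow> (\<Sum>j\<in>N. Q i j * x j) \<ge> 0"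
    and "i \<in> N" "j \<in> N"
  shows "x i = x j"
proof -
  define T where "T = {i \<in> N. \<forall>j\<in>N. x i \<le> x j}"
  have ne: "T \<noteq> {}"
    using ex_is_arg_min_if_finite[OF laplacian_finite, of x] assms(2)
    by (auto simp: T_def is_arg_min_def not_less)
  have "T = N"
  proof (rule ccontr)
    assume "T \<noteq> N"
    then have "T \<subset> N" by (auto simp: T_def)
    from laplacian_cut[OF ne this] obtain p q where pq: "p \<in> T" "q \<in> N - T" "Q p q \<noteq> 0" by blast
    have p: "p \<in> N" "\<And>j. j \<in> N \<Longrightarrow> x p \<le> x j" using pq by (auto simp: T_def)
    obtain r where r: "r \<in> N" "x r < x q" using pq by (auto simp: T_def not_le)
    have xq: "x p < x q" using r p(2)[of r] by simp
    have "(\<Sum>j\<in>N. Q p j * x j) = (\<Sum>j\<in>N. Q p j * (x j - x p))"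
      using laplacian_row_sum[OF p(1)] by (simp add: right_diff_distrib sum_subtractf flip: sum_distrib_right)
    also have "\<dots> < (\<Sum>j\<in>N. 0)"
    proof (rule sum_strict_mono_ex1[OF laplacian_finite])
      show "\<forall>j\<in>N. Q p j * (x j - x p) \<le> 0"
      proof
        fix j assume j: "j \<in> N"
        show "Q p j * (x j - x p) \<le> 0"
          using laplacian_nonpos[OF p(1) j] p(2)[OF j]
          by (cases "p = j") (auto intro: mult_nonpos_nonneg)
      qed
      have "Q p q < 0" using laplacian_nonpos[of p q] p pq by force
      then show "\<exists>j\<in>N. Q p j * (x j - x p) < 0"
        using pq xq by (intro bexI[of _ q]) (auto intro: mult_neg_pos)
    qed
    finally show False using min[OF p(1)] p(2) by simp
  qed
  with assms show ?thesis by (auto simp: T_def intro: antisym)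
qed

text \<open>Extend \<open>x\<close> by zero. If it had a negative entry, all minimisers of the
  extension would lie in \<open>W\<close>, so the extension would be constant, although it vanishes
  off \<open>W\<close>.\<close>

lemma block_inverse_positive:
  assumes "W \<subset> N"
    and pos: "\<And>i. i \<in> W \<Longrightarrow> (\<Sum>j\<in>W. Q i j * x j) \<ge> 0"
    and "i \<in> W"
  shows "x i \<ge> 0"
proof (rule ccontr)
  assume "\<not> x i \<ge> 0"
  define y where "y = (\<lambda>j. if j \<in> W then x j else 0)"
  obtain v where v: "v \<in> N" "v \<notin> W" using assms(1) by blast
  have iN: "i \<in> N" using assms by blast
  have "y i = y v"
  proof (rule minimum_principle[OF _ iN v(1)])
    fix k assume k: "k \<in> N" "\<forall>j\<in>N. y k \<le> y j"
    then have "y k \<le> y i" using iN by blast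
    with \<open>\<not> x i \<ge> 0\<close> \<open>i \<in> W\<close> have "k \<in> W" by (auto simp: y_def split: if_splits)
    have "(\<Sum>j\<in>N. Q k j * y j) = (\<Sum>j\<in>W. Q k j * x j)"
      using laplacian_finite assms(1) by (intro sum.mono_neutral_cong_right) (auto simp: y_def)
    with pos[OF \<open>k \<in> W\<close>] show "(\<Sum>j\<in>N. Q k j * y j) \<ge> 0" by simp
  qed
  with v \<open>i \<in> W\<close> \<open>\<not> x i \<ge> 0\<close> show False by (simp add: y_def)
qed

lemma block_kernel_trivial:
  assumes "W \<subset> N" "\<forall>i\<in>W. (\<Sum>j\<in>W. Q i j * x j) = 0"
  shows "\<forall>i\<in>W. x i = 0"
proof
  fix i assume i: "i \<in> W"
  have "x i \<ge> 0" using block_inverse_positive[OF assms(1) _ i] assms(2) by simp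
  moreover have "- x i \<ge> 0"
    using block_inverse_positive[OF assms(1) _ i, of "\<lambda>i. - x i"] assms(2) by (simp add: sum_negf)
  ultimately show "x i = 0" by simp
qed

section \<open>The Schur complement\<close>

text \<open>Replaces the chosen inverse by the linear equations it solves; all later arguments use
  only these.\<close>

lemma schur_complement_solution:
  assumes W: "W \<subset> N"
  obtains H where "\<And>i j. i \<in> W \<Longrightarrow> (\<Sum>k\<in>W. Q i k * H k j) = Q i j"
    and "\<And>i j. schur_complement Q W i j = Q i j - (\<Sum>k\<in>W. Q i k * H k j)"
proof -
  have finW: "finite W" using W laplacian_finite finite_subset by blast
  define B where "B = inverse_on W Q"
  define H where "H = (\<lambda>k j. \<Sum>l\<in>W. B k l * Q l j)"
  \<comment> \<open>Every subset of \<open>W\<close> is again a proper subset of \<open>N\<close>,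
    so all sub-blocks have trivial kernel.\<close>
  have "\<exists>B. is_inverse_on W Q B"
    by (rule is_inverse_on_exists[OF finW], rule block_kernel_trivial) (use W in auto)
  then have "is_inverse_on W Q B"
    unfolding B_def inverse_on_def by (rule someI_ex)
  then have QB: "(\<Sum>k\<in>W. Q i k * B k l) = (if i = l then 1 else 0)"
    if "i \<in> W" "l \<in> W" for i l
    using that unfolding is_inverse_on_def mult_on_def by blast
  have swap: "(\<Sum>k\<in>W. Q i k * H k j) = (\<Sum>l\<in>W. (\<Sum>k\<in>W. Q i k * B k l) * Q l j)" for i j
    unfolding H_def sum_distrib_left sum_distrib_right
    by (subst sum.swap) (simp add: mult.assoc)
  show ?thesis
  proof
    show "schur_complement Q W i j = Q i j - (\<Sum>k\<in>W. Q i k * H k j)" for i j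
      unfolding swap by (simp add: schur_complement_def mult_on_def B_def)
    fix i j assume i: "i \<in> W"
    have "(\<Sum>k\<in>W. Q i k * H k j) = (\<Sum>l\<in>W. if l = i then Q l j else 0)"
      unfolding swap by (intro sum.cong) (auto simp: QB i)
    then show "(\<Sum>k\<in>W. Q i k * H k j) = Q i j" using i finW by simp
  qed
qed

lemma schur_complement_irreducible:
  assumes V: "V \<subset> N" and c2: "card V \<ge> 2"
  shows "irreducible_laplacian V (schur_complement Q (N - V))"
proof -
  define W where "W = N - V"
  define S where "S = schur_complement Q W"
  have "V \<noteq> {}" using c2 by auto
  then have W: "W \<subset> N" using V by (auto simp: W_def)
  have finV: "finite V" and finW: "finite W" using V W laplacian_finite finite_subset by blast+
  have split: "(\<Sum>j\<in>N. f j) = (\<Sum>j\<in>V. f j) + (\<Sum>j\<in>W. f j)" for f :: "'a \<Rightarrow> real"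
    using V laplacian_finite unfolding W_def by (subst sum.subset_diff[of V N f]) auto
  have VN: "i \<in> N" if "i \<in> V" for i using that V by blast
  have WN: "i \<in> N" "i \<notin> V" if "i \<in> W" for i using that W_def by auto
  obtain H where H: "\<And>i j. i \<in> W \<Longrightarrow> (\<Sum>k\<in>W. Q i k * H k j) = Q i j"
    and S: "\<And>i j. S i j = Q i j - (\<Sum>k\<in>W. Q i k * H k j)"
    unfolding S_def by (rule schur_complement_solution[OF W]) blast
  have Hneg: "H k j \<le> 0" if k: "k \<in> W" and j: "j \<in> V" for k j
  proof -
    have "(\<Sum>l\<in>W. Q i l * - H l j) \<ge> 0" if i: "i \<in> W" for i
      using H[OF i, of j] laplacian_nonpos[of i j] VN[OF j] WN[OF i] j by (auto simp: sum_negf)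
    from block_inverse_positive[OF W this k] show ?thesis by simp
  qed
  \<comment> \<open>Since the rows of \<open>Q\<close> sum to zero, the row sums of \<open>H\<close>
    over \<open>V\<close> and the constant -1 solve the same system on \<open>W\<close>.\<close>
  have Hrow: "(\<Sum>j\<in>V. H k j) = -1" if k: "k \<in> W" for k
  proof -
    have "(\<Sum>l\<in>W. Q i l * ((\<Sum>j\<in>V. H l j) + 1)) = 0" if i: "i \<in> W" for i
    proof -
      have "(\<Sum>l\<in>W. Q i l * (\<Sum>j\<in>V. H l j)) = (\<Sum>j\<in>V. \<Sum>l\<in>W. Q i l * H l j)"
        unfolding sum_distrib_left by (rule sum.swap)
      also have "\<dots> = (\<Sum>j\<in>V. Q i j)" using H[OF i] by simp
      finally show ?thesis
        using laplacian_row_sum[OF WN(1)[OF i]] split[of "Q i"] by (simp add: distrib_left sum.distrib)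
    qed
    with block_kernel_trivial[OF W, of "\<lambda>l. (\<Sum>j\<in>V. H l j) + 1"] k show ?thesis by force
  qed
  have "S i j = S j i" if i: "i \<in> V" and j: "j \<in> V" for i j
  proof -
    \<comment> \<open>Substituting the equations for \<open>H\<close> writes the correction term as
      the form \<open>H^T Q H\<close> over \<open>W\<close>, which is symmetric because
      \<open>Q\<close> is.\<close>
    have expand: "(\<Sum>k\<in>W. Q i k * H k j) = (\<Sum>k\<in>W. \<Sum>l\<in>W. Q k l * H l i * H k j)"
      if "i \<in> V" for i j
    proof (rule sum.cong[OF refl])
      fix k assume k: "k \<in> W"
      show "Q i k * H k j = (\<Sum>l\<in>W. Q k l * H l i * H k j)"
        using H[OF k, of i] laplacian_sym[OF VN[OF that] WN(1)[OF k]]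
        by (simp flip: sum_distrib_right)
    qed
    have "(\<Sum>k\<in>W. \<Sum>l\<in>W. Q k l * H l i * H k j) = (\<Sum>l\<in>W. \<Sum>k\<in>W. Q k l * H l i * H k j)"
      by (rule sum.swap)
    also have "\<dots> = (\<Sum>k\<in>W. \<Sum>l\<in>W. Q k l * H l j * H k i)"
      using laplacian_sym WN(1) by (intro sum.cong refl) simp
    finally show ?thesis
      using i j laplacian_sym[OF VN VN, OF i j] by (simp add: S expand)
  qed
  moreover have "S i j \<le> 0" if ij: "i \<in> V" "j \<in> V" "i \<noteq> j" for i j
  proof -
    have "(\<Sum>k\<in>W. Q i k * H k j) \<ge> 0"
    proof (rule sum_nonneg)
      fix k assume k: "k \<in> W"
      then have "i \<noteq> k" using WN ij by blast
      then show "Q i k * H k j \<ge> 0"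
        using laplacian_nonpos[OF VN[OF ij(1)] WN(1)[OF k]] Hneg[OF k ij(2)] by (simp add: mult_nonpos_nonpos)
    qed
    with laplacian_nonpos[OF VN VN, OF ij] show ?thesis by (simp add: S)
  qed
  moreover have Srow: "(\<Sum>j\<in>V. S i j) = 0" if i: "i \<in> V" for i
  proof -
    have "(\<Sum>j\<in>V. \<Sum>k\<in>W. Q i k * H k j) = (\<Sum>k\<in>W. Q i k * (\<Sum>j\<in>V. H k j))"
      unfolding sum_distrib_left by (rule sum.swap)
    also have "\<dots> = - (\<Sum>k\<in>W. Q i k)" by (simp add: Hrow sum_negf)
    finally show ?thesis
      using laplacian_row_sum[OF VN[OF i]] split[of "Q i"] by (simp add: S sum_subtractf)
  qed
  moreover have "\<exists>i\<in>T. \<exists>j\<in>V-T. S i j \<noteq> 0" if T: "T \<noteq> {}" "T \<subset> V" for T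
  proof (rule ccontr)
    assume "\<not> ?thesis"
    then have zero: "\<And>i j. i \<in> T \<Longrightarrow> j \<in> V - T \<Longrightarrow> S i j = 0" by blast
    have finT: "finite T" using T finV finite_subset by blast
    define u where "u = (\<lambda>k. if k \<in> W then - (\<Sum>j\<in>T. H k j) else if k \<in> T then 1 else 0)"
    have Qu: "(\<Sum>j\<in>N. Q i j * u j) = (\<Sum>j\<in>T. S i j)" for i
    proof -
      have "(\<Sum>j\<in>V. Q i j * u j) = (\<Sum>j\<in>T. Q i j)"
        using T finV by (intro sum.mono_neutral_cong_right) (auto simp: u_def dest: WN)
      moreover have "(\<Sum>k\<in>W. Q i k * u k) = - (\<Sum>j\<in>T. \<Sum>k\<in>W. Q i k * H k j)"
        by (subst sum.swap) (simp add: u_def sum_distrib_left sum_negf)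
      ultimately show ?thesis by (simp add: split S sum_subtractf)
    qed
    \<comment> \<open>Rows in \<open>W\<close> of \<open>S\<close> vanish by the equations for
      \<open>H\<close>; rows in \<open>V - T\<close> vanish on \<open>T\<close> by symmetry and the
      assumed decoupling; rows in \<open>T\<close> have their whole zero row sum concentrated on
      \<open>T\<close>.\<close>
    have ST: "(\<Sum>j\<in>T. S i j) = 0" if i: "i \<in> N" for i
    proof -
      consider "i \<in> W" | "i \<in> V - T" | "i \<in> T" using i T by (auto simp: W_def)
      then show ?thesis
      proof cases
        case 1
        then show ?thesis by (simp add: S H)
      next
        case 2
        have "S i j = 0" if "j \<in> T" for j
          using zero[OF that 2] \<open>\<And>i j. i \<in> V \<Longrightarrow> j \<in> V \<Longrightarrow> S i j = S j i\<close>[of i j] 2 T that by auto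
        then show ?thesis by simp
      next
        case 3
        have "(\<Sum>j\<in>V. S i j) = (\<Sum>j\<in>T. S i j)"
          using T finV zero[OF 3] by (intro sum.mono_neutral_right) auto
        with Srow 3 T show ?thesis by auto
      qed
    qed
    obtain a b where ab: "a \<in> T" "b \<in> V - T" using T by blast
    then have abN: "a \<in> N" "b \<in> N" using T V by auto
    have "u a = u b"
      by (rule minimum_principle[OF _ abN]) (simp add: Qu ST)
    moreover have "a \<notin> W" "b \<notin> W" using ab T WN by auto
    ultimately show False using ab by (simp add: u_def)
  qed
  ultimately have "irreducible_laplacian V S"
    using finV c2 unfolding irreducible_laplacian_def by blast
  then show ?thesis by (simp add: S_def W_def)
qed

end

theorem mainTheorem2:
  fixes N V :: "'a set" and Q :: "'a \<Rightarrow> 'a \<Rightarrow> real"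
  assumes "is_laplacian N Q"
    and "V \<subset> N"
    and "card V \<ge> 2"
  shows "is_laplacian V (schur_complement Q (N - V))"
  by (rule irreducible_imp_is_laplacian
      [OF schur_complement_irreducible[OF is_laplacian_imp_irreducible[OF assms(1)] assms(2,3)]])

end
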